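(* Let $n\ge 2$ and $1\le d\le n-1$ be integers, and let $K,L\subseteq\mathbb{R}^n$ be compact convex sets. The following are equivalent: (i) For every $d$-decomposable compact convex set $C\subseteq\mathbb{R}^n$ such that $L\subseteq C$, there exists $v\in\mathbb{R}^n$ such that $K+v\subseteq C$. (ii) For every $d$-decomposable orthogonal simplex product $C\subseteq\mathbb{R}^n$ such that $L\subseteq C$, there exists $v\in\mathbb{R}^n$ such that $K+v\subseteq C$. (iii) For every $d$-dimensional linear subspace $\xi\subseteq\mathbb{R}^n$, there exists $w\in\xi$ such that $K_\xi+w\subseteq L_\xi$.
   Context: All compact convex sets are nonempty. For a linear subspace $\xi$ of $\mathbb{R}^n$, $K_\xi$ denotes the orthogonal projection of $K$ onto $\xi$. A compact convex set $C\subseteq\mathbb{R}^n$ is $d$-decomposable if there exist a direct sum decomposition into linear subspaces $\mathbb{R}^n=\xi_1\oplus\cdots\oplus\xi_m$ with $\dim\xi_i\le d$ for each $i$, and compact convex sets $C_i\subseteq\xi_i$, such that $C=C_1+\cdots+C_m$ (Minkowski sum); this is written $C=C_1\oplus\cdots\oplus C_m$. If moreover each $C_i$ is a simplex (of dimension at most $d$), $C$ is called a $d$-decomposable simplex product; it is called orthogonal if the subspaces $\xi_1,\dots,\xi_m$ are mutually orthogonal. *)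

theory Defs
  imports "HOL-Analysis.Analysis"
begin

definition compact_convex :: "'a::euclidean_space set \<Rightarrow> bool" where
  "compact_convex C \<longleftrightarrow> compact C \<and> convex C \<and> C \<noteq> {}"

text \<open>
  The whole space is the (internal) direct sum of the linear subspaces \<open>\<xi> 0, \<dots>, \<xi> (m - 1)\<close>.
  The extensional function space is used so that the uniqueness of the
  components of \<open>x\<close> is not spoilt by the values of \<open>f\<close> outside \<open>{..<m}\<close>.
\<close>

definition direct_sum_decomposition :: "nat \<Rightarrow> (nat \<Rightarrow> 'a::euclidean_space set) \<Rightarrow> bool" where
  "direct_sum_decomposition m \<xi> \<longleftrightarrow>
     (\<forall>i<m. subspace (\<xi> i)) \<and>
     (\<forall>x. \<exists>!f. f \<in> (\<Pi>\<^sub>E i\<in>{..<m}. \<xi> i) \<and> x = (\<Sum>i<m. f i))"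

text \<open>
  \<open>C = C\<^sub>1 \<oplus> \<dots> \<oplus> C\<^sub>m\<close> with respect to subspaces of dimension at most \<open>d\<close>.
  The sum of the sets \<open>D i\<close> is the Minkowski sum of \<^theory>\<open>HOL-Library.Set_Algebras\<close>.
\<close>

definition d_decomposition ::
    "nat \<Rightarrow> 'a::euclidean_space set \<Rightarrow> nat \<Rightarrow> (nat \<Rightarrow> 'a set) \<Rightarrow> (nat \<Rightarrow> 'a set) \<Rightarrow> bool" where
  "d_decomposition d C m \<xi> D \<longleftrightarrow>
     direct_sum_decomposition m \<xi> \<and> (\<forall>i<m. dim (\<xi> i) \<le> d) \<and>
     (\<forall>i<m. compact_convex (D i) \<and> D i \<subseteq> \<xi> i) \<and>
     C = (\<Sum>i<m. D i)"

definition d_decomposable :: "nat \<Rightarrow> 'a::euclidean_space set \<Rightarrow> bool" where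
  "d_decomposable d C \<longleftrightarrow> compact_convex C \<and> (\<exists>m \<xi> D. d_decomposition d C m \<xi> D)"

text \<open>
  Simplices may be degenerate (down to a single point), but the library's \<open>(-1)\<close>-simplex,
  the empty set, is excluded by the lower bound on \<open>k\<close>.
\<close>

definition orthogonal_simplex_product :: "nat \<Rightarrow> 'a::euclidean_space set \<Rightarrow> bool" where
  "orthogonal_simplex_product d C \<longleftrightarrow> compact_convex C \<and>
     (\<exists>m \<xi> D. d_decomposition d C m \<xi> D \<and>
        (\<forall>i<m. \<exists>k\<in>{0..int d}. k simplex (D i)) \<and>
        (\<forall>i<m. \<forall>j<m. i \<noteq> j \<longrightarrow> (\<forall>x\<in>\<xi> i. \<forall>y\<in>\<xi> j. orthogonal x y)))"

definition orth_proj :: "'a::euclidean_space set \<Rightarrow> 'a \<Rightarrow> 'a" where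
  "orth_proj \<xi> x = (THE p. p \<in> \<xi> \<and> (\<forall>y\<in>\<xi>. orthogonal (x - p) y))"

lemma orth_proj_ex1:
  fixes \<xi> :: "'a::euclidean_space set"
  assumes "subspace \<xi>"
  shows "\<exists>!p. p \<in> \<xi> \<and> (\<forall>y\<in>\<xi>. orthogonal (x - p) y)"
proof -
  obtain p z where p: "p \<in> span \<xi>" "\<And>w. w \<in> span \<xi> \<Longrightarrow> orthogonal z w" "x = p + z"
    using orthogonal_subspace_decomp_exists by metis
  have s: "span \<xi> = \<xi>"
    using assms by (simp add: span_eq_iff)
  have "q = p" if q: "q \<in> \<xi>" "\<forall>y\<in>\<xi>. orthogonal (x - q) y" for q
  proof -
    have m: "p - q \<in> \<xi>"
      using assms p(1) q(1) s by (auto intro: subspace_diff)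
    have "(x - q) \<bullet> (p - q) = 0" "z \<bullet> (p - q) = 0"
      using q(2) p(2) m s by (auto simp: orthogonal_def)
    hence "(p - q) \<bullet> (p - q) = 0"
      using p(3) by (simp add: algebra_simps inner_diff_left inner_add_left)
    thus ?thesis by simp
  qed
  thus ?thesis using p s by (intro ex1I[of _ p]) auto
qed

lemma orth_proj:
  fixes \<xi> :: "'a::euclidean_space set"
  assumes "subspace \<xi>"
  shows orth_proj_in: "orth_proj \<xi> x \<in> \<xi>"
    and orth_proj_orthogonal: "y \<in> \<xi> \<Longrightarrow> orthogonal (x - orth_proj \<xi> x) y"
  using theI'[OF orth_proj_ex1[OF assms, of x]] by (auto simp: orth_proj_def)

end

theory Submission
  imports Defs
begin

text \<open>
  For (iii) \<open>\<Longrightarrow>\<close> (i), the projection onto a summand \<open>\<xi> i\<close> along the other summands factors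
  through the orthogonal projection onto the orthogonal complement of its kernel, whose dimension is
  at most \<open>d\<close>; so each component of \<open>K\<close> can be translated separately.

  For (ii) \<open>\<Longrightarrow>\<close> (iii), a translation \<open>w\<close> as in (iii) is a solution in \<open>\<xi>\<close> of the inequalities
  \<open>w \<bullet> u \<le> h\<^sub>L u - h\<^sub>K u\<close> between support functions, for \<open>u \<in> \<xi>\<close>.  If there is none, compactness
  and Farkas' lemma give finitely many \<open>u\<close> and weights \<open>k u > 0\<close> with \<open>\<Sum> k u *\<^sub>R u = 0\<close> and
  \<open>\<Sum> k u * (h\<^sub>L u - h\<^sub>K u) < 0\<close>.  When the set \<open>S\<close> of these \<open>u\<close> is minimal, the half-spaces
  \<open>x \<bullet> u \<le> h\<^sub>L u + \<epsilon>\<close> cut out a simplex of \<open>span S\<close>, and the product of this simplex with a large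
  box contains \<open>L\<close> but no translate of \<open>K\<close>.
\<close>

section \<open>Farkas' lemma for finite systems of linear inequalities\<close>

text \<open>The weights are read off from \<open>(0, -1)\<close> lying in the closed cone generated
  by \<open>(0, 1)\<close> and the points \<open>(u, f u)\<close>. Otherwise a functional
  \<open>(a, b)\<close> with \<open>b > 0\<close> separates it from the cone, and
  \<open>w = - a / b\<close> would satisfy all inequalities.\<close>

lemma farkas_alternative:
  fixes f :: "'a::euclidean_space \<Rightarrow> real"
  assumes fin: "finite F" and infeasible: "\<And>w. \<exists>u\<in>F. f u < w \<bullet> u"
  obtains l where "\<forall>u\<in>F. 0 \<le> l u" "(\<Sum>u\<in>F. l u *\<^sub>R u) = 0" "(\<Sum>u\<in>F. l u * f u) < 0"
proof -
  \<comment> \<open>The generator \<open>(0, 1)\<close> supplies the slack \<open>s\<close> in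
    \<open>R\<close>; discarding it at the end leaves a weighted sum of at most -1.\<close>
  define Q where "Q = convex_cone hull (insert (0, 1) ((\<lambda>u. (u, f u)) ` F))"
  define R where "R = {((\<Sum>u\<in>F. l u *\<^sub>R u), (\<Sum>u\<in>F. l u * f u) + s) | l s.
      (\<forall>u\<in>F. 0 \<le> l u) \<and> 0 \<le> (s::real)}"
  have "convex_cone R"
    unfolding convex_cone_iff
  proof (intro conjI ballI allI impI)
    show "0 \<in> R"
      by (auto simp: R_def zero_prod_def intro!: exI[of _ "\<lambda>_. 0"] exI[of _ 0])
  next
    fix x y assume "x \<in> R" "y \<in> R"
    then obtain l s k t where
      "x = ((\<Sum>u\<in>F. l u *\<^sub>R u), (\<Sum>u\<in>F. l u * f u) + s)" "\<forall>u\<in>F. 0 \<le> l u" "0 \<le> s"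
      "y = ((\<Sum>u\<in>F. k u *\<^sub>R u), (\<Sum>u\<in>F. k u * f u) + t)" "\<forall>u\<in>F. 0 \<le> k u" "0 \<le> t"
      by (auto simp: R_def)
    then show "x + y \<in> R"
      by (auto simp: R_def algebra_simps sum.distrib intro!: exI[of _ "\<lambda>u. l u + k u"] exI[of _ "s + t"])
  next
    fix x and c :: real assume "x \<in> R" "0 \<le> c"
    then obtain l s where
      "x = ((\<Sum>u\<in>F. l u *\<^sub>R u), (\<Sum>u\<in>F. l u * f u) + s)" "\<forall>u\<in>F. 0 \<le> l u" "0 \<le> s"
      by (auto simp: R_def)
    then show "c *\<^sub>R x \<in> R"
      using \<open>0 \<le> c\<close>
      by (auto simp: R_def algebra_simps scaleR_sum_right sum_distrib_left
          intro!: exI[of _ "\<lambda>u. c * l u"] exI[of _ "c * s"])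
  qed
  moreover have "insert (0, 1) ((\<lambda>u. (u, f u)) ` F) \<subseteq> R"
  proof -
    have "(0, 1) \<in> R"
      by (auto simp: R_def intro!: exI[of _ "\<lambda>_. 0"] exI[of _ 1])
    moreover have "(u, f u) \<in> R" if "u \<in> F" for u
    proof -
      have "(\<Sum>v\<in>F. (if v = u then 1 else 0) *\<^sub>R v) = (\<Sum>v\<in>F. if v = u then v else 0)"
        "(\<Sum>v\<in>F. (if v = u then 1 else 0) * f v) = (\<Sum>v\<in>F. if v = u then f v else 0)"
        by (auto intro!: sum.cong)
      then show ?thesis
        using that fin
        by (auto simp: R_def intro!: exI[of _ "\<lambda>v. if v = u then 1 else 0"] exI[of _ 0])
    qed
    ultimately show ?thesis by auto
  qed
  ultimately have "Q \<subseteq> R"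
    unfolding Q_def by (simp add: hull_minimal)
  have "(0, -1) \<in> Q"
  proof (rule ccontr)
    assume "(0, -1) \<notin> Q"
    moreover have "convex Q" "closed Q"
      using fin by (auto simp: Q_def convex_convex_cone_hull intro!: closed_convex_cone_hull)
    ultimately obtain p c where pc: "p \<bullet> (0, -1) < c" "\<And>q. q \<in> Q \<Longrightarrow> c < p \<bullet> q"
      using separating_hyperplane_closed_point by metis
    obtain a b where p: "p = (a, b)" by fastforce
    have "c < 0"
      using pc(2)[of 0] convex_cone_hull_contains_0 by (auto simp: Q_def)
    have nonneg: "0 \<le> p \<bullet> q" if "q \<in> Q" for q
    proof (rule ccontr)
      assume n: "\<not> 0 \<le> p \<bullet> q"
      \<comment> \<open>This multiple of \<open>q\<close> would have the value exactly
        \<open>c\<close> under the functional, against the strict separation.\<close>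
      have "(c / (p \<bullet> q)) *\<^sub>R q \<in> Q"
        using that n \<open>c < 0\<close> unfolding Q_def
        by (intro convex_cone_hull_mul) (auto simp: divide_nonpos_neg)
      from pc(2)[OF this] show False using n by simp
    qed
    have "b > 0"
      using pc(1) \<open>c < 0\<close> nonneg[of "(0, 1)"] by (auto simp: p Q_def hull_inc)
    obtain u where u: "u \<in> F" "f u < (- (1 / b) *\<^sub>R a) \<bullet> u"
      using infeasible by blast
    have "(u, f u) \<in> Q"
      using u(1) by (auto simp: Q_def hull_inc)
    from nonneg[OF this] have "0 \<le> a \<bullet> u + b * f u"
      by (simp add: p)
    with u(2) \<open>b > 0\<close> show False
      by (simp add: field_simps)
  qed
  with \<open>Q \<subseteq> R\<close> obtain l s where "(\<Sum>u\<in>F. l u *\<^sub>R u) = 0"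
    "(\<Sum>u\<in>F. l u * f u) + s = -1" "\<forall>u\<in>F. 0 \<le> l u" "0 \<le> s"
    unfolding R_def by fastforce
  then show thesis
    by (intro that[of l]) auto
qed

section \<open>Minimal positive linear relations\<close>

text \<open>A circuit of the linear matroid whose relation has positive coefficients: the last
  clause says that all linear relations on \<open>S\<close> form the line through \<open>k\<close>.
  The empty set qualifies, so later uses must exclude it.\<close>

definition positive_circuit :: "'a::real_vector set \<Rightarrow> ('a \<Rightarrow> real) \<Rightarrow> bool" where
  "positive_circuit S k \<longleftrightarrow> (\<forall>u\<in>S. 0 < k u) \<and> (\<Sum>u\<in>S. k u *\<^sub>R u) = 0 \<and>
     (\<forall>m. (\<Sum>u\<in>S. m u *\<^sub>R u) = 0 \<longrightarrow> (\<exists>c. \<forall>u\<in>S. m u = c * k u))"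

text \<open>A reduction in the manner of Caratheodory: while some relation on \<open>F\<close> is
  not a multiple of \<open>l\<close>, the weights can be moved along a relation until one of them
  vanishes; its vector is dropped and induction applies.\<close>

lemma exists_positive_circuit:
  fixes f :: "'a::real_vector \<Rightarrow> real"
  assumes "finite F" "\<forall>u\<in>F. 0 \<le> l u" "(\<Sum>u\<in>F. l u *\<^sub>R u) = 0" "(\<Sum>u\<in>F. l u * f u) < 0"
  shows "\<exists>S\<subseteq>F. \<exists>k. positive_circuit S k \<and> (\<Sum>u\<in>S. k u * f u) < 0"
  using assms
proof (induction F arbitrary: l rule: finite_psubset_induct)
  case (psubset F)
  have comb: "(\<Sum>u\<in>F. (a u + t * b u) *\<^sub>R u) = (\<Sum>u\<in>F. a u *\<^sub>R u) + t *\<^sub>R (\<Sum>u\<in>F. b u *\<^sub>R u)"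
    "(\<Sum>u\<in>F. (a u + t * b u) * f u) = (\<Sum>u\<in>F. a u * f u) + t * (\<Sum>u\<in>F. b u * f u)" for a b t
    by (simp_all add: algebra_simps sum.distrib scaleR_sum_right sum_distrib_left)
  have drop: ?case if k: "\<forall>u\<in>F. 0 \<le> k u" "(\<Sum>u\<in>F. k u *\<^sub>R u) = 0" "(\<Sum>u\<in>F. k u * f u) < 0"
    and z: "z \<in> F" "k z = 0" for k z
  proof -
    have "F - {z} \<subset> F" using z by auto
    moreover have "(\<Sum>u\<in>F - {z}. k u *\<^sub>R u) = 0" "(\<Sum>u\<in>F - {z}. k u * f u) < 0"
      using k z psubset.hyps by (simp_all add: sum.remove[of F z])
    moreover have "\<forall>u\<in>F - {z}. 0 \<le> k u" using k(1) by simp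
    ultimately show ?thesis
      using psubset.IH[of "F - {z}" k] by blast
  qed
  show ?case
  proof (cases "\<exists>z\<in>F. l z = 0")
    case True
    then show ?thesis using drop[OF psubset.prems] by blast
  next
    case False
    then have pos: "\<forall>u\<in>F. 0 < l u" using psubset.prems(1) by force
    show ?thesis
    proof (cases "\<forall>m. (\<Sum>u\<in>F. m u *\<^sub>R u) = 0 \<longrightarrow> (\<exists>c. \<forall>u\<in>F. m u = c * l u)")
      case True
      with pos psubset.prems(2,3) show ?thesis
        unfolding positive_circuit_def by blast
    next
      case False
      then obtain m where m: "(\<Sum>u\<in>F. m u *\<^sub>R u) = 0" "\<And>c. \<exists>u\<in>F. m u \<noteq> c * l u"
        by blast
      \<comment> \<open>Subtracting \<open>c * l\<close> makes the \<open>f\<close>-sum of the second relation vanish, so adding multiples of it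
        to \<open>l\<close> keeps the \<open>f\<close>-sum negative until some weight becomes zero.\<close>
      define c where "c = (\<Sum>u\<in>F. m u * f u) / (\<Sum>u\<in>F. l u * f u)"
      define p where "p u = m u - c * l u" for u
      have p: "(\<Sum>u\<in>F. p u *\<^sub>R u) = 0" "(\<Sum>u\<in>F. p u * f u) = 0"
        using m(1) psubset.prems(2,3) comb[of m "- c" l] by (simp_all add: p_def c_def)
      \<comment> \<open>\<open>p\<close> does not vanish on \<open>F\<close>, as \<open>m\<close> is
        not a multiple of \<open>l\<close>; hence \<open>p\<close> or its negative takes a negative
        value.\<close>
      obtain q where q: "(\<Sum>u\<in>F. q u *\<^sub>R u) = 0" "(\<Sum>u\<in>F. q u * f u) = 0" "\<exists>u\<in>F. q u < 0"
      proof (cases "\<exists>u\<in>F. p u < 0")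
        case True
        then show ?thesis using p that by blast
      next
        case False
        with m(2)[of c] have "\<exists>u\<in>F. - p u < 0" by (force simp: p_def)
        then show ?thesis using p that[of "\<lambda>u. - p u"] by (simp add: sum_negf)
      qed
      let ?N = "{u\<in>F. q u < 0}"
      \<comment> \<open>The largest step that keeps all weights nonnegative; a minimiser
        \<open>z\<close> reaches weight zero.\<close>
      define t where "t = Min ((\<lambda>u. - l u / q u) ` ?N)"
      have N: "finite ?N" "?N \<noteq> {}" using q(3) psubset.hyps by auto
      then have "t \<in> (\<lambda>u. - l u / q u) ` ?N"
        unfolding t_def by (intro Min_in) auto
      then obtain z where z: "z \<in> ?N" "t = - l z / q z" by blast
      have t_le: "t \<le> - l u / q u" if "u \<in> ?N" for u
        using N that unfolding t_def by (intro Min_le) auto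
      have "t \<ge> 0" using z pos by (auto simp: divide_nonneg_neg less_imp_le)
      show ?thesis
      proof (rule drop[of "\<lambda>u. l u + t * q u" z])
        show "\<forall>u\<in>F. 0 \<le> l u + t * q u"
        proof
          fix u assume u: "u \<in> F"
          show "0 \<le> l u + t * q u"
          proof (cases "q u < 0")
            case True
            then have "t \<le> - l u / q u" using t_le u by simp
            then show ?thesis using True by (simp add: field_simps)
          next
            case False
            then show ?thesis using u pos \<open>t \<ge> 0\<close> by (simp add: less_imp_le)
          qed
        qed
        show "(\<Sum>u\<in>F. (l u + t * q u) *\<^sub>R u) = 0"
          using q psubset.prems by (simp add: comb)
        show "(\<Sum>u\<in>F. (l u + t * q u) * f u) < 0"
          using q psubset.prems by (simp add: comb)
        show "z \<in> F" "l z + t * q z = 0" using z by auto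
      qed
    qed
  qed
qed

text \<open>This makes weighted sums over a circuit blind to translations: adding
  \<open>v \<bullet> u\<close> to the bound for each \<open>u\<close> changes nothing.\<close>

lemma sum_inner_positive_circuit:
  assumes "positive_circuit S k"
  shows "(\<Sum>u\<in>S. k u * (x \<bullet> u)) = 0"
proof -
  have "x \<bullet> (\<Sum>u\<in>S. k u *\<^sub>R u) = 0"
    using assms by (simp add: positive_circuit_def)
  then show ?thesis by (simp add: inner_sum_right)
qed

text \<open>A relation on the remaining vectors, extended by 0 at \<open>z\<close>, is a multiple
  \<open>c * k\<close> vanishing at \<open>z\<close>, so \<open>c = 0\<close> because
  \<open>k z > 0\<close>. Solving the relation \<open>k\<close> for \<open>z\<close> gives the
  second claim.\<close>

lemma positive_circuit_remove:
  assumes "positive_circuit S k" "finite S" "z \<in> S"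
  shows "independent (S - {z})" "z \<in> span (S - {z})"
proof -
  have pos: "\<And>u. u \<in> S \<Longrightarrow> 0 < k u" and rel: "(\<Sum>u\<in>S. k u *\<^sub>R u) = 0"
    and uniq: "\<And>m. (\<Sum>u\<in>S. m u *\<^sub>R u) = 0 \<Longrightarrow> \<exists>c. \<forall>u\<in>S. m u = c * k u"
    using assms(1) by (auto simp: positive_circuit_def)
  show "independent (S - {z})"
  proof (rule independent_if_scalars_zero)
    fix m x assume m: "(\<Sum>u\<in>S - {z}. m u *\<^sub>R u) = 0" and x: "x \<in> S - {z}"
    have "(\<Sum>u\<in>S. (m(z := 0)) u *\<^sub>R u) = (\<Sum>u\<in>S - {z}. m u *\<^sub>R u)"
      using assms by (simp add: sum.remove[of S z])
    with m uniq obtain c where c: "\<forall>u\<in>S. (m(z := 0)) u = c * k u" by metis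
    with assms(3) pos[of z] have "c = 0" by force
    with bspec[OF c, of x] x show "m x = 0" by simp
  qed (use assms in auto)
  have "k z *\<^sub>R z = - (\<Sum>u\<in>S - {z}. k u *\<^sub>R u)"
    using rel assms by (simp add: sum.remove[of S z] eq_neg_iff_add_eq_0)
  then have "z = - ((1 / k z) *\<^sub>R (\<Sum>u\<in>S - {z}. k u *\<^sub>R u))"
    using pos[OF assms(3)] by (metis divide_self_if less_irrefl scaleR_minus_right scaleR_one
        scaleR_scaleR times_divide_eq_left mult_1)
  also have "\<dots> \<in> span (S - {z})"
    by (intro span_neg span_scale span_sum span_base) auto
  finally show "z \<in> span (S - {z})" .
qed

text \<open>Removing one element leaves a basis of the span.\<close>

lemma card_positive_circuit:
  fixes S :: "'a::euclidean_space set"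
  assumes "positive_circuit S k" "finite S" "S \<noteq> {}"
  shows "card S = dim (span S) + 1"
proof -
  obtain z where z: "z \<in> S" using assms(3) by blast
  have "span S = span (S - {z})"
    using positive_circuit_remove(2)[OF assms(1,2) z] z by (metis insert_Diff span_redundant)
  moreover have "dim (S - {z}) = card (S - {z})"
    using positive_circuit_remove(1)[OF assms(1,2) z] by (rule dim_eq_card_independent)
  ultimately have "dim (span S) = card (S - {z})"
    by (simp add: dim_span)
  then show ?thesis
    using z assms(2) by (metis Suc_eq_plus1 card_Suc_Diff1)
qed

section \<open>The simplex cut out by a circuit\<close>

lemma inner_orth_proj:
  assumes "subspace \<xi>" "u \<in> \<xi>"
  shows "orth_proj \<xi> x \<bullet> u = x \<bullet> u"
  using orth_proj_orthogonal[OF assms, of x] by (simp add: orthogonal_def inner_diff_left)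

lemma inner_eq_on_span:
  assumes "x \<in> span S" "y \<in> span S" "\<And>u. u \<in> S \<Longrightarrow> x \<bullet> u = y \<bullet> u"
  shows "x = y"
  by (rule vector_eq_dot_span[OF assms(1,2)]) (use assms(3) in \<open>simp add: inner_commute\<close>)

text \<open>The prescription extends to a linear functional, represented by the vector
  \<open>adjoint f 1\<close>; projecting this vector onto \<open>span B\<close> preserves its inner
  products with \<open>B\<close>.\<close>

lemma exists_prescribed_inner:
  fixes B :: "'a::euclidean_space set"
  assumes "independent B"
  obtains v where "v \<in> span B" "\<And>u. u \<in> B \<Longrightarrow> v \<bullet> u = g u"
proof -
  obtain f :: "'a \<Rightarrow> real" where f: "linear f" "\<forall>u\<in>B. f u = g u"
    using linear_independent_extend[OF assms] by blast
  define v where "v = orth_proj (span B) (adjoint f 1)"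
  have "v \<bullet> u = g u" if "u \<in> B" for u
    using that f adjoint_works[OF f(1), of u 1] inner_orth_proj[of "span B" u "adjoint f 1"]
    by (simp add: v_def span_base inner_commute)
  moreover have "v \<in> span B"
    by (simp add: v_def orth_proj_in)
  ultimately show thesis by (rule that[rotated])
qed

text \<open>The vertex \<open>V z\<close> is the point where all constraints except that of
  \<open>z\<close> are tight. The slacks of any point, weighted by \<open>k\<close>, sum to
  \<open>G > 0\<close>, so divided by \<open>G\<close> they serve as barycentric
  coordinates.\<close>

lemma circuit_polytope_simplex:
  fixes S :: "'a::euclidean_space set"
  assumes circ: "positive_circuit S k" and fin: "finite S" and pos_sum: "0 < (\<Sum>u\<in>S. k u * g u)"
  shows "(int (card S) - 1) simplex {x \<in> span S. \<forall>u\<in>S. x \<bullet> u \<le> g u}"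
proof -
  define G where "G = (\<Sum>u\<in>S. k u * g u)"
  have G: "0 < G" using pos_sum by (simp add: G_def)
  have pos: "\<And>u. u \<in> S \<Longrightarrow> 0 < k u"
    using circ by (auto simp: positive_circuit_def)
  note rel_inner = sum_inner_positive_circuit[OF circ]
  have "\<exists>v. v \<in> span S \<and> (\<forall>u\<in>S - {z}. v \<bullet> u = g u)" if z: "z \<in> S" for z
  proof -
    obtain v where "v \<in> span (S - {z})" "\<And>u. u \<in> S - {z} \<Longrightarrow> v \<bullet> u = g u"
      using exists_prescribed_inner[OF positive_circuit_remove(1)[OF circ fin z]] by metis
    then show ?thesis
      using span_mono[of "S - {z}" S] by blast
  qed
  then obtain V where V_span: "\<And>z. z \<in> S \<Longrightarrow> V z \<in> span S"
    and V_other: "\<And>z u. z \<in> S \<Longrightarrow> u \<in> S \<Longrightarrow> u \<noteq> z \<Longrightarrow> V z \<bullet> u = g u"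
    by (metis DiffI singletonD)
  \<comment> \<open>At \<open>V z\<close> only the slack of \<open>z\<close> survives, so it must
    account for all of \<open>G\<close>.\<close>
  have V_self: "V z \<bullet> z = g z - G / k z" if z: "z \<in> S" for z
  proof -
    have "(\<Sum>u\<in>S. k u * (g u - V z \<bullet> u)) = k z * (g z - V z \<bullet> z)"
      using z V_other fin by (simp add: sum.remove[of S z])
    moreover have "(\<Sum>u\<in>S. k u * (g u - V z \<bullet> u)) = G"
      by (simp add: right_diff_distrib sum_subtractf rel_inner G_def)
    ultimately show ?thesis using pos[OF z] by (simp add: field_simps)
  qed
  have V_inner: "V z \<bullet> u = g u - (if u = z then G / k z else 0)" if "z \<in> S" "u \<in> S" for z u
    using that V_self V_other by auto
  \<comment> \<open>Pairing with \<open>u\<close> isolates the coefficient \<open>b u\<close> up to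
    the total weight. This yields both affine independence (total 0) and the recovery of points
    (total 1).\<close>
  have comb: "(\<Sum>z\<in>S. b z *\<^sub>R V z) \<bullet> u = g u * sum b S - b u * G / k u" if "u \<in> S" for b u
  proof -
    have "(\<Sum>z\<in>S. b z *\<^sub>R V z) \<bullet> u = (\<Sum>z\<in>S. g u * b z - (if u = z then b z * G / k z else 0))"
      unfolding inner_sum_left by (intro sum.cong) (auto simp: V_inner that algebra_simps)
    also have "\<dots> = g u * sum b S - b u * G / k u"
      using that fin by (simp add: sum_subtractf sum_distrib_left)
    finally show ?thesis .
  qed
  have inj: "inj_on V S"
  proof (rule inj_onI, rule ccontr)
    fix y z assume yz: "y \<in> S" "z \<in> S" "V y = V z" "y \<noteq> z"
    then have "G / k z = 0" using V_inner[of y z] V_inner[of z z] by simp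
    with G pos[OF yz(2)] show False by simp
  qed
  have "\<not> affine_dependent (V ` S)"
    unfolding affine_dependent_explicit_finite[OF finite_imageI[OF fin]]
  proof clarify
    fix U z assume U: "sum U (V ` S) = 0" "(\<Sum>v\<in>V ` S. U v *\<^sub>R v) = 0"
      and z: "z \<in> S" "U (V z) \<noteq> 0"
    have "(\<Sum>y\<in>S. U (V y)) = 0" "(\<Sum>y\<in>S. U (V y) *\<^sub>R V y) = 0"
      using U by (simp_all add: sum.reindex[OF inj])
    with comb[OF z(1), of "\<lambda>y. U (V y)"] have "U (V z) * G / k z = 0" by simp
    with G pos[OF z(1)] z(2) show False by simp
  qed
  moreover have "card (V ` S) = card S" using inj by (rule card_image)
  moreover have "{x \<in> span S. \<forall>u\<in>S. x \<bullet> u \<le> g u} = convex hull (V ` S)" (is "?P = _")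
  proof
    show "convex hull (V ` S) \<subseteq> ?P"
    proof (rule hull_minimal)
      show "V ` S \<subseteq> ?P"
        using V_span V_inner G pos by (auto simp: less_imp_le)
      have "?P = span S \<inter> (\<Inter>u\<in>S. {x. u \<bullet> x \<le> g u})"
        by (auto simp: inner_commute)
      then show "convex ?P"
        by (simp add: convex_Int convex_INT convex_halfspace_le subspace_imp_convex)
    qed
    show "?P \<subseteq> convex hull (V ` S)"
    proof clarify
      fix x assume x: "x \<in> span S" "\<forall>u\<in>S. x \<bullet> u \<le> g u"
      \<comment> \<open>The barycentric coordinates of \<open>x\<close>: its weighted slacks,
        normalised by \<open>G\<close>.\<close>
      define b where "b u = k u * (g u - x \<bullet> u) / G" for u
      have b: "sum b S = 1"
      proof -
        have "sum b S = (\<Sum>u\<in>S. k u * (g u - x \<bullet> u)) / G"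
          by (simp add: b_def sum_divide_distrib)
        also have "\<dots> = 1"
          using G by (simp add: right_diff_distrib sum_subtractf rel_inner flip: G_def)
        finally show ?thesis .
      qed
      have "(\<Sum>z\<in>S. b z *\<^sub>R V z) = x"
      proof (rule inner_eq_on_span)
        show "(\<Sum>z\<in>S. b z *\<^sub>R V z) \<in> span S"
          by (intro span_sum span_scale V_span)
        fix u assume u: "u \<in> S"
        then show "(\<Sum>z\<in>S. b z *\<^sub>R V z) \<bullet> u = x \<bullet> u"
          using G pos[OF u] by (simp add: comb b) (simp add: b_def)
      qed (rule x)
      moreover have "(\<Sum>z\<in>S. b z *\<^sub>R V z) \<in> convex hull (V ` S)"
        by (rule convex_sum[OF fin convex_convex_hull b])
          (use x(2) G pos in \<open>simp_all add: b_def hull_inc less_imp_le\<close>)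
      ultimately show "x \<in> convex hull (V ` S)" by simp
    qed
  qed
  ultimately show ?thesis
    by (simp add: simplex_convex_hull)
qed

section \<open>Support functions and inclusion of projections\<close>

lemma linear_orth_proj:
  assumes "subspace \<xi>"
  shows "linear (orth_proj \<xi>)"
proof -
  have eqI: "orth_proj \<xi> x = p" if "p \<in> \<xi>" "\<And>y. y \<in> \<xi> \<Longrightarrow> (x - p) \<bullet> y = 0" for x p
    unfolding orth_proj_def
    by (rule the1_equality[OF orth_proj_ex1[OF assms]]) (use that in \<open>auto simp: orthogonal_def\<close>)
  show ?thesis
  proof (rule linearI)
    fix x y show "orth_proj \<xi> (x + y) = orth_proj \<xi> x + orth_proj \<xi> y"
      by (rule eqI)
        (simp_all add: assms subspace_add orth_proj_in inner_add_left inner_diff_left inner_orth_proj)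
  next
    fix c x show "orth_proj \<xi> (c *\<^sub>R x) = c *\<^sub>R orth_proj \<xi> x"
      by (rule eqI) (simp_all add: assms subspace_scale orth_proj_in inner_diff_left inner_orth_proj)
  qed
qed

lemma exists_support_function:
  fixes L :: "'a::euclidean_space set"
  assumes "compact_convex L"
  obtains h where "\<And>x u. x \<in> L \<Longrightarrow> x \<bullet> u \<le> h u" "\<And>u. \<exists>x\<in>L. h u = x \<bullet> u"
proof -
  have "\<exists>c. (\<exists>x\<in>L. c = x \<bullet> u) \<and> (\<forall>y\<in>L. y \<bullet> u \<le> c)" for u
  proof -
    have "\<exists>x\<in>L. \<forall>y\<in>L. y \<bullet> u \<le> x \<bullet> u"
      using assms by (intro continuous_attains_sup continuous_intros) (auto simp: compact_convex_def)
    then show ?thesis by blast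
  qed
  then obtain h where "\<And>u. (\<exists>x\<in>L. h u = x \<bullet> u) \<and> (\<forall>y\<in>L. y \<bullet> u \<le> h u)"
    by metis
  then show thesis by (intro that[of h]) auto
qed

text \<open>A projected point outside the compact convex projection of \<open>L\<close> would be
  strictly separated from it, and the separating direction would violate \<open>le\<close>.\<close>

lemma translate_orth_proj_subset:
  fixes K L :: "'a::euclidean_space set"
  assumes \<xi>: "subspace \<xi>" and L: "compact_convex L" and w: "w \<in> \<xi>"
    and h: "\<And>u. \<exists>x\<in>L. h u = x \<bullet> u"
    and le: "\<And>x u. x \<in> K \<Longrightarrow> u \<in> \<xi> \<Longrightarrow> (x + w) \<bullet> u \<le> h u"
  shows "(\<lambda>x. x + w) ` (orth_proj \<xi> ` K) \<subseteq> orth_proj \<xi> ` L"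
proof clarify
  fix x assume x: "x \<in> K"
  let ?P = "orth_proj \<xi> ` L" and ?y = "orth_proj \<xi> x + w"
  note lin = linear_orth_proj[OF \<xi>]
  show "?y \<in> ?P"
  proof (rule ccontr)
    assume "?y \<notin> ?P"
    moreover have "convex ?P" "closed ?P"
      using L lin
      by (auto simp: compact_convex_def convex_linear_image
          intro!: compact_imp_closed compact_continuous_image linear_continuous_on
          simp: linear_conv_bounded_linear)
    ultimately obtain a b where ab: "a \<bullet> ?y < b" "\<And>z. z \<in> ?P \<Longrightarrow> b < a \<bullet> z"
      using separating_hyperplane_closed_point by metis
    \<comment> \<open>Projecting \<open>a\<close> gives a direction inside \<xi>, where
      \<open>le\<close> applies. The sign turns the lower bound from the separation into an upper
      bound.\<close>
    define u where "u = - orth_proj \<xi> a"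
    have u: "u \<in> \<xi>" by (simp add: u_def \<xi> orth_proj_in subspace_neg)
    have inner_u: "z \<bullet> u = - (a \<bullet> z)" if "z \<in> \<xi>" for z
      using inner_orth_proj[OF \<xi> that, of a] by (simp add: u_def inner_commute)
    obtain z where z: "z \<in> L" "h u = z \<bullet> u" using h by blast
    have "a \<bullet> ?y = - ((x + w) \<bullet> u)"
      using inner_u[of ?y] inner_orth_proj[OF \<xi> u, of x] w
      by (simp add: \<xi> orth_proj_in subspace_add inner_add_left)
    moreover have "a \<bullet> orth_proj \<xi> z = - (z \<bullet> u)"
      using inner_u[of "orth_proj \<xi> z"] inner_orth_proj[OF \<xi> u, of z] by (simp add: \<xi> orth_proj_in)
    ultimately show False
      using le[OF x u] z(2) ab(1) ab(2)[of "orth_proj \<xi> z"] z(1) by auto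
  qed
qed

text \<open>Finitely many of the constraints already confine \<open>w\<close> to a compact subset
  \<open>W\<close> of \<xi>, so the finite intersection property leaves a finite infeasible
  subsystem.\<close>

lemma finite_infeasible_subset:
  fixes f :: "'a::euclidean_space \<Rightarrow> real"
  assumes \<xi>: "subspace \<xi>" and infeasible: "\<And>w. w \<in> \<xi> \<Longrightarrow> \<exists>u\<in>\<xi>. f u < w \<bullet> u"
  obtains F where "finite F" "F \<subseteq> \<xi>" "\<And>w. \<exists>u\<in>F. f u < w \<bullet> u"
proof -
  define p where "p = orth_proj \<xi>"
  have p_in: "p x \<in> \<xi>" for x by (simp add: p_def \<xi> orth_proj_in)
  have p_inner: "w \<bullet> p b = w \<bullet> b" if "w \<in> \<xi>" for w b
    using inner_orth_proj[OF \<xi> that, of b] by (simp add: p_def inner_commute)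
  define H where "H u = {w. w \<bullet> u \<le> f u}" for u
  \<comment> \<open>For \<open>w\<close> in \<xi>, pairing with \<open>p b\<close> gives the
    coordinate \<open>w \<bullet> b\<close>; so these directions bound every coordinate from both
    sides.\<close>
  define E where "E = p ` Basis \<union> (\<lambda>b. - p b) ` Basis"
  define W where "W = \<xi> \<inter> (\<Inter>u\<in>E. H u)"
  have E: "finite E" "E \<subseteq> \<xi>" using p_in \<xi> by (auto simp: E_def subspace_neg)
  have closed_H: "closed (H u)" for u
    using closed_halfspace_le[of u "f u"] by (simp add: H_def inner_commute)
  have "bounded W"
  proof (rule bounded_subset[OF bounded_cbox])
    show "W \<subseteq> cbox (\<Sum>b\<in>Basis. - f (- p b) *\<^sub>R b) (\<Sum>b\<in>Basis. f (p b) *\<^sub>R b)"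
    proof
      fix w assume "w \<in> W"
      then have w: "w \<in> \<xi>" and H: "\<And>u. u \<in> E \<Longrightarrow> w \<bullet> u \<le> f u"
        by (auto simp: W_def H_def)
      have "w \<bullet> b \<le> f (p b)" "- f (- p b) \<le> w \<bullet> b" if "b \<in> Basis" for b
        using that H[of "p b"] H[of "- p b"] p_inner[OF w, of b] by (auto simp: E_def)
      then show "w \<in> cbox (\<Sum>b\<in>Basis. - f (- p b) *\<^sub>R b) (\<Sum>b\<in>Basis. f (p b) *\<^sub>R b)"
        by (auto simp: mem_box simp del: scaleR_minus_left)
    qed
  qed
  moreover have "closed W"
    unfolding W_def by (intro closed_Int closed_INT ballI closed_subspace \<xi> closed_H)
  ultimately have "compact W" by (simp add: compact_eq_bounded_closed)
  moreover have "W \<inter> (\<Inter>u\<in>\<xi>. H u) = {}"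
    using infeasible by (fastforce simp: W_def H_def)
  ultimately obtain I where I: "finite I" "I \<subseteq> \<xi>" "W \<inter> (\<Inter>u\<in>I. H u) = {}"
    using compact_imp_fip_image[of W \<xi> H] closed_H by metis
  show thesis
  proof (rule that)
    show "finite (E \<union> I)" "E \<union> I \<subseteq> \<xi>" using E I by auto
    fix w
    \<comment> \<open>An arbitrary \<open>w\<close> has the same inner products with vectors of
      \<xi> as its projection, so infeasibility extends to the whole space.\<close>
    have "p w \<in> \<xi>" by (rule p_in)
    with I(3) obtain u where u: "u \<in> E \<union> I" "\<not> p w \<bullet> u \<le> f u"
      unfolding W_def H_def by blast
    moreover have "p w \<bullet> u = w \<bullet> u"
      using u(1) \<open>E \<union> I \<subseteq> \<xi>\<close> by (auto simp: p_def intro!: inner_orth_proj \<xi>)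
    ultimately show "\<exists>u\<in>E \<union> I. f u < w \<bullet> u"
      by (intro bexI[of _ u]) auto
  qed
qed

section \<open>Orthogonal sums and cylinders over a simplex\<close>

text \<open>Uniqueness is the point: the difference of two representations sums to 0, and pairing
  that sum with its \<open>j\<close>-th term leaves only \<open>h j \<bullet> h j\<close>.\<close>

lemma orthogonal_direct_sum_decomposition:
  assumes sub: "\<And>i. i < m \<Longrightarrow> subspace (\<xi> i)"
    and orth: "\<And>i j x y. i < m \<Longrightarrow> j < m \<Longrightarrow> i \<noteq> j \<Longrightarrow> x \<in> \<xi> i \<Longrightarrow> y \<in> \<xi> j \<Longrightarrow> x \<bullet> y = 0"
    and ex: "\<And>x. \<exists>f. (\<forall>i<m. f i \<in> \<xi> i) \<and> x = (\<Sum>i<m. f i)"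
  shows "direct_sum_decomposition m \<xi>"
  unfolding direct_sum_decomposition_def
proof (intro conjI allI impI)
  fix x
  show "\<exists>!f. f \<in> (\<Pi>\<^sub>E i\<in>{..<m}. \<xi> i) \<and> x = (\<Sum>i<m. f i)"
  proof (rule ex_ex1I)
    obtain f where "\<forall>i<m. f i \<in> \<xi> i" "x = (\<Sum>i<m. f i)" using ex by blast
    then show "\<exists>f. f \<in> (\<Pi>\<^sub>E i\<in>{..<m}. \<xi> i) \<and> x = (\<Sum>i<m. f i)"
      by (intro exI[of _ "restrict f {..<m}"]) auto
  next
    fix f g
    assume f: "f \<in> (\<Pi>\<^sub>E i\<in>{..<m}. \<xi> i) \<and> x = (\<Sum>i<m. f i)"
      and g: "g \<in> (\<Pi>\<^sub>E i\<in>{..<m}. \<xi> i) \<and> x = (\<Sum>i<m. g i)"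
    define h where "h i = f i - g i" for i
    have h: "h i \<in> \<xi> i" if "i < m" for i
      using f g that sub by (auto simp: h_def PiE_iff intro!: subspace_diff)
    have "(\<Sum>i<m. h i) = 0" using f g by (simp add: h_def sum_subtractf)
    have "h j = 0" if j: "j < m" for j
    proof -
      have "0 = (\<Sum>i<m. h i) \<bullet> h j" using \<open>(\<Sum>i<m. h i) = 0\<close> by simp
      also have "\<dots> = (\<Sum>i<m. h i \<bullet> h j)" by (rule inner_sum_left)
      also have "\<dots> = h j \<bullet> h j + (\<Sum>i\<in>{..<m} - {j}. h i \<bullet> h j)"
        using j by (simp add: sum.remove)
      also have "(\<Sum>i\<in>{..<m} - {j}. h i \<bullet> h j) = 0"
        using orth[OF _ j _ h h[OF j]] by (intro sum.neutral) auto
      finally show ?thesis by simp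
    qed
    then show "f = g"
      using f g by (intro PiE_ext[of f "{..<m}" \<xi> g]) (auto simp: h_def)
  qed
qed (rule sub)

lemma mem_set_sum_lessThan:
  fixes D :: "nat \<Rightarrow> 'a::comm_monoid_add set"
  shows "c \<in> (\<Sum>i<m. D i) \<longleftrightarrow> (\<exists>s. (\<forall>i<m. s i \<in> D i) \<and> c = (\<Sum>i<m. s i))"
  by (subst set_sum_alt) auto

lemma compact_convex_set_sum:
  fixes D :: "nat \<Rightarrow> 'a::euclidean_space set"
  assumes "\<And>i. i < m \<Longrightarrow> compact_convex (D i)"
  shows "compact_convex (\<Sum>i<m. D i)"
  using assms
proof (induction m)
  case 0
  then show ?case by (simp add: compact_convex_def set_zero)
next
  case (Suc m)
  then have "compact_convex (\<Sum>i<m. D i)" "compact_convex (D m)" by auto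
  moreover have "compact (A + B)" if "compact A" "compact B" for A B :: "'a set"
    using compact_sums'[OF that] by (auto simp: set_plus_def elim!: back_subst[of compact])
  ultimately show ?case
    by (auto simp: compact_convex_def convex_set_plus intro: set_plus_intro)
qed

lemma simplex_compact_convex:
  assumes "k simplex S" "0 \<le> k"
  shows "compact_convex S"
proof -
  have "S \<noteq> {}" using assms by (auto simp: simplex_def)
  then show ?thesis
    using assms(1) by (simp add: compact_convex_def compact_simplex convex_simplex)
qed

lemma segment_simplex:
  fixes a b :: "'a::euclidean_space"
  assumes "a \<noteq> b"
  shows "1 simplex (closed_segment a b)"
  unfolding segment_convex_hull
  by (rule simplex_convex_hull) (use assms in \<open>auto simp: affine_independent_2\<close>)

text \<open>The orthogonal complement of \<open>\<eta>\<close> is filled with long segments in orthogonal directions;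
  they are \<open>1\<close>-simplices, which is why \<open>1 \<le> d\<close> is needed.\<close>

lemma simplex_cylinder:
  fixes \<eta> L T :: "'a::euclidean_space set"
  assumes \<eta>: "subspace \<eta>" "dim \<eta> \<le> d" and d: "1 \<le> d"
    and T: "k simplex T" "0 \<le> k" "k \<le> int d" "T \<subseteq> \<eta>"
    and L: "bounded L" "orth_proj \<eta> ` L \<subseteq> T"
  obtains C where "orthogonal_simplex_product d C" "L \<subseteq> C"
    "\<And>c. c \<in> C \<Longrightarrow> \<exists>t\<in>T. \<forall>u\<in>\<eta>. c \<bullet> u = t \<bullet> u"
proof -
  obtain B where B: "B \<subseteq> \<eta>\<^sup>\<bottom>" "pairwise orthogonal B" "\<And>x. x \<in> B \<Longrightarrow> norm x = 1"
    "independent B" "span B = \<eta>\<^sup>\<bottom>"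
    using orthonormal_basis_subspace[OF subspace_orthogonal_comp] by metis
  have fin: "finite B" using B(4) by (rule independent_imp_finite)
  obtain e where e: "bij_betw e {..<card B} B"
    using ex_bij_betw_nat_finite[OF fin] by (auto simp: atLeast0LessThan)
  let ?n = "card B"
  have e_in: "e j \<in> B" if "j < ?n" for j using e that by (auto simp: bij_betw_def)
  have e_perp: "x \<bullet> e j = 0" if "j < ?n" "x \<in> \<eta>" for x j
    using e_in[OF that(1)] B(1) that(2) by (auto simp: orthogonal_comp_def orthogonal_def)
  have e_norm: "norm (e j) = 1" if "j < ?n" for j using e_in[OF that] B(3) by blast
  have e_orth: "e i \<bullet> e j = 0" if "i < ?n" "j < ?n" "i \<noteq> j" for i j
  proof -
    have "e i \<noteq> e j" using e that by (auto simp: bij_betw_def inj_on_def)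
    then show ?thesis
      using B(2) e_in that by (auto simp: pairwise_def orthogonal_def)
  qed
  obtain R where R: "R > 0" "\<And>x. x \<in> L \<Longrightarrow> norm x \<le> R"
    using L(1) by (auto simp: bounded_pos)
  \<comment> \<open>Index 0 carries \<eta> with \<open>T\<close>; index \<open>Suc j\<close> carries
    the line through \<open>e j\<close> with a segment of half-length \<open>R\<close>.\<close>
  define \<xi> where "\<xi> i = (case i of 0 \<Rightarrow> \<eta> | Suc j \<Rightarrow> span {e j})" for i
  define D where "D i = (case i of 0 \<Rightarrow> T | Suc j \<Rightarrow> closed_segment (- R *\<^sub>R e j) (R *\<^sub>R e j))" for i
  define C where "C = (\<Sum>i<Suc ?n. D i)"
  define part where "part x i = (case i of 0 \<Rightarrow> orth_proj \<eta> x | Suc j \<Rightarrow> (x \<bullet> e j) *\<^sub>R e j)" for x i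
  have part_sum: "x = (\<Sum>i<Suc ?n. part x i)" for x
  proof -
    let ?z = "x - orth_proj \<eta> x"
    have "?z \<in> span B"
      using orth_proj_orthogonal[OF \<eta>(1), of _ x] B(5)
      by (auto simp: orthogonal_comp_def orthogonal_commute)
    \<comment> \<open>The part of \<open>x\<close> orthogonal to \<eta> expands in the orthonormal
      basis \<open>B\<close>.\<close>
    then have "?z = (\<Sum>b\<in>B. (?z \<bullet> b) *\<^sub>R b)"
      using orthonormal_basis_expand[OF B(2,3) _ fin, of ?z] by simp
    also have "\<dots> = (\<Sum>j<?n. (?z \<bullet> e j) *\<^sub>R e j)"
      by (rule sum.reindex_bij_betw[OF e, symmetric])
    also have "\<dots> = (\<Sum>j<?n. (x \<bullet> e j) *\<^sub>R e j)"
      using e_perp by (intro sum.cong) (simp_all add: inner_diff_left \<eta>(1) orth_proj_in)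
    finally have "x = orth_proj \<eta> x + (\<Sum>j<?n. (x \<bullet> e j) *\<^sub>R e j)"
      by (simp add: diff_eq_eq add.commute)
    then show ?thesis
      by (simp add: part_def sum.lessThan_Suc_shift del: sum.lessThan_Suc)
  qed
  have part_in: "part x i \<in> \<xi> i" for x i
    by (cases i) (auto simp: part_def \<xi>_def \<eta>(1) orth_proj_in span_base span_scale)
  have sub: "subspace (\<xi> i)" for i
    by (cases i) (simp_all add: \<xi>_def \<eta>(1))
  have orth: "x \<bullet> y = 0" if ij: "i < Suc ?n" "j < Suc ?n" "i \<noteq> j" and "x \<in> \<xi> i" "y \<in> \<xi> j" for i j x y
    using that e_perp e_perp[THEN inner_commute[THEN trans]] e_orth
    by (cases i; cases j) (auto simp: \<xi>_def span_singleton)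
  have dim: "dim (\<xi> i) \<le> d" for i
  proof (cases i)
    case (Suc j)
    have "dim {e j} \<le> card {e j}" by (rule dim_le_card') simp
    then show ?thesis using Suc d by (simp add: \<xi>_def dim_span)
  qed (simp add: \<xi>_def \<eta>(2))
  have simp_D: "\<exists>k\<in>{0..int d}. k simplex (D i)" if "i < Suc ?n" for i
  proof (cases i)
    case 0
    then show ?thesis using T by (auto simp: D_def)
  next
    case (Suc j)
    then have "e j \<noteq> 0" using e_norm[of j] that by auto
    then have "- R *\<^sub>R e j \<noteq> R *\<^sub>R e j"
      using R(1) unfolding scaleR_cancel_right by simp
    then show ?thesis
      using Suc d segment_simplex by (intro bexI[of _ 1]) (auto simp: D_def)
  qed
  have D_sub: "D i \<subseteq> \<xi> i" for i
    by (cases i)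
      (auto simp: D_def \<xi>_def T(4) closed_segment_subset subspace_imp_convex span_base span_scale span_neg
        intro!: closed_segment_subset T(4)[THEN subsetD])
  have D_cc: "compact_convex (D i)" if "i < Suc ?n" for i
    using simp_D[OF that] simplex_compact_convex by auto
  have "d_decomposition d C (Suc ?n) \<xi> D"
    unfolding d_decomposition_def
  proof (intro conjI allI impI)
    show "direct_sum_decomposition (Suc ?n) \<xi>"
      by (rule orthogonal_direct_sum_decomposition) (use sub orth part_sum part_in in blast)+
  qed (use dim D_cc D_sub C_def in auto)
  moreover have "compact_convex C"
    unfolding C_def by (rule compact_convex_set_sum) (rule D_cc)
  ultimately have "orthogonal_simplex_product d C"
    unfolding orthogonal_simplex_product_def orthogonal_def using simp_D orth by blast
  moreover have "L \<subseteq> C"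
  proof
    fix x assume x: "x \<in> L"
    have "part x i \<in> D i" if "i < Suc ?n" for i
    proof (cases i)
      case 0
      then show ?thesis using L(2) x by (auto simp: part_def D_def)
    next
      case (Suc j)
      define s where "s = x \<bullet> e j"
      have "\<bar>s\<bar> \<le> R"
        using Cauchy_Schwarz_ineq2[of x "e j"] R(2)[OF x] e_norm[of j] that Suc by (simp add: s_def)
      \<comment> \<open>Position of \<open>s\<close> on the segment: \<open>s = - R\<close> has
        parameter 0 and \<open>s = R\<close> has parameter 1.\<close>
      then have "s *\<^sub>R e j = (1 - (s + R) / (2 * R)) *\<^sub>R (- R *\<^sub>R e j) + ((s + R) / (2 * R)) *\<^sub>R (R *\<^sub>R e j)"
        "0 \<le> (s + R) / (2 * R)" "(s + R) / (2 * R) \<le> 1"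
        using R(1) by (auto simp: field_simps simp flip: scaleR_left_distrib scaleR_left_diff_distrib)
      then have "s *\<^sub>R e j \<in> closed_segment (- R *\<^sub>R e j) (R *\<^sub>R e j)"
        unfolding closed_segment_def by blast
      then show ?thesis by (simp add: Suc D_def part_def s_def)
    qed
    then show "x \<in> C"
      unfolding C_def mem_set_sum_lessThan using part_sum[of x] by blast
  qed
  moreover have "\<exists>t\<in>T. \<forall>u\<in>\<eta>. c \<bullet> u = t \<bullet> u" if c: "c \<in> C" for c
  proof -
    obtain s where s: "\<And>i. i < Suc ?n \<Longrightarrow> s i \<in> D i" "c = (\<Sum>i<Suc ?n. s i)"
      using c unfolding C_def mem_set_sum_lessThan by blast
    \<comment> \<open>The segments are orthogonal to \<eta>, so only the summand from
      \<open>T\<close> is visible to \<open>u\<close>.\<close>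
    have "c \<bullet> u = s 0 \<bullet> u" if u: "u \<in> \<eta>" for u
    proof -
      have "s (Suc j) \<bullet> u = 0" if "j < ?n" for j
        using orth[of "Suc j" 0 "s (Suc j)" u] s(1)[of "Suc j"] D_sub[of "Suc j"] u that
        by (auto simp: \<xi>_def)
      then show ?thesis
        unfolding s(2) sum.lessThan_Suc_shift by (simp add: inner_add_left inner_sum_left)
    qed
    moreover have "s 0 \<in> T" using s(1)[of 0] by (simp add: D_def)
    ultimately show ?thesis by blast
  qed
  ultimately show thesis by (rule that)
qed

section \<open>Components along a direct sum\<close>

locale direct_sum =
  fixes m and \<xi> :: "nat \<Rightarrow> 'a::euclidean_space set"
  assumes decomp: "direct_sum_decomposition m \<xi>"
begin

lemma subspace: "i < m \<Longrightarrow> subspace (\<xi> i)"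
  using decomp by (simp add: direct_sum_decomposition_def)

definition component :: "'a \<Rightarrow> nat \<Rightarrow> 'a" where
  "component x = (THE f. f \<in> (\<Pi>\<^sub>E i\<in>{..<m}. \<xi> i) \<and> x = (\<Sum>i<m. f i))"

lemma component:
  shows component_in: "i < m \<Longrightarrow> component x i \<in> \<xi> i"
    and component_sum: "(\<Sum>i<m. component x i) = x"
proof -
  have "component x \<in> (\<Pi>\<^sub>E i\<in>{..<m}. \<xi> i) \<and> x = (\<Sum>i<m. component x i)"
    unfolding component_def
    using theI'[of "\<lambda>f. f \<in> (\<Pi>\<^sub>E i\<in>{..<m}. \<xi> i) \<and> x = (\<Sum>i<m. f i)"] decomp
    by (simp add: direct_sum_decomposition_def)
  then show "i < m \<Longrightarrow> component x i \<in> \<xi> i" "(\<Sum>i<m. component x i) = x"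
    by auto
qed

lemma component_eqI:
  assumes "\<And>i. i < m \<Longrightarrow> f i \<in> \<xi> i" "x = (\<Sum>i<m. f i)" "i < m"
  shows "component x i = f i"
proof -
  have "component x = restrict f {..<m}"
    unfolding component_def
    by (rule the1_equality)
      (use decomp assms in \<open>auto simp: direct_sum_decomposition_def\<close>)
  then show ?thesis using assms(3) by simp
qed

lemma linear_component:
  assumes "i < m"
  shows "linear (\<lambda>x. component x i)"
proof (rule linearI)
  show "component (x + y) i = component x i + component y i" for x y
    using assms
    by (intro component_eqI[where f = "\<lambda>i. component x i + component y i"])
      (auto simp: sum.distrib component_sum component_in subspace intro!: subspace_add)
  show "component (c *\<^sub>R x) i = c *\<^sub>R component x i" for c x
    using assms
    by (intro component_eqI[where f = "\<lambda>i. c *\<^sub>R component x i"])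
      (auto simp: component_sum component_in subspace simp flip: scaleR_sum_right intro!: subspace_scale)
qed

end

text \<open>\<open>f\<close> is unchanged by the projection onto \<zeta> once the orthogonal
  complement of \<zeta> lies in the kernel \<open>N\<close>. Injectivity on the complement of
  \<open>N\<close> bounds the dimension of that complement by the rank.\<close>

lemma exists_orth_proj_factor:
  fixes f :: "'a::euclidean_space \<Rightarrow> 'b::euclidean_space"
  assumes lin: "linear f" and rank: "dim (range f) \<le> d" and d: "d \<le> DIM('a)"
  obtains \<zeta> where "subspace \<zeta>" "dim \<zeta> = d" "\<And>x. f (orth_proj \<zeta> x) = f x"
proof -
  define N where "N = f -` {0}"
  have N: "subspace N"
    unfolding N_def by (rule linear_subspace_vimage[OF lin]) simp
  have "inj_on f (N\<^sup>\<bottom>)"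
  proof -
    have "x = 0" if "x \<in> N\<^sup>\<bottom>" "f x = 0" for x
      using that orthogonal_Int_0[OF N] by (auto simp: N_def)
    then show ?thesis
      by (simp add: linear_inj_on_iff_eq_0[OF lin subspace_orthogonal_comp])
  qed
  then have "dim (N\<^sup>\<bottom>) = dim (f ` (N\<^sup>\<bottom>))"
    using dim_image_eq[OF lin, of "N\<^sup>\<bottom>"]
    by (simp add: subspace_orthogonal_comp span_eq_iff[THEN iffD2])
  also have "\<dots> \<le> d"
    by (rule order_trans[OF dim_subset rank]) auto
  finally have dN: "dim (N\<^sup>\<bottom>) \<le> d" .
  have dim_comp: "dim (U\<^sup>\<bottom>) + dim U = DIM('a)" if "subspace U" for U :: "'a set"
    using dim_subspace_orthogonal_to_vectors[OF that subspace_UNIV] by (simp add: orthogonal_comp_def)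
  have "DIM('a) - d \<le> dim N" using dN dim_comp[OF N] by linarith
  \<comment> \<open>Shrinking the kernel enlarges its complement to dimension exactly
    \<open>d\<close>, the dimension for which translations will be available.\<close>
  then obtain M where M: "subspace M" "M \<subseteq> N" "dim M = DIM('a) - d"
    using choose_subspace_of_subspace[of "DIM('a) - d" N] N by (metis span_eq_iff)
  show thesis
  proof (rule that)
    show sub: "subspace (M\<^sup>\<bottom>)" by (rule subspace_orthogonal_comp)
    show "dim (M\<^sup>\<bottom>) = d" using dim_comp[OF M(1)] M(3) d by linarith
    show "f (orth_proj (M\<^sup>\<bottom>) x) = f x" for x
    proof -
      have "x - orth_proj (M\<^sup>\<bottom>) x \<in> M\<^sup>\<bottom>\<^sup>\<bottom>"
        using orth_proj_orthogonal[OF sub, of _ x]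
        by (auto simp: orthogonal_comp_def[of "M\<^sup>\<bottom>"] orthogonal_commute)
      then have "f (x - orth_proj (M\<^sup>\<bottom>) x) = 0"
        using M(2) by (auto simp: orthogonal_comp_self[OF M(1)] N_def)
      then show ?thesis by (simp add: linear_diff[OF lin])
    qed
  qed
qed

section \<open>The two main implications\<close>

lemma translate_into_d_decomposable:
  fixes K L C :: "'a::euclidean_space set"
  assumes d: "d \<le> DIM('a)" and C: "d_decomposable d C" and LC: "L \<subseteq> C"
    and proj: "\<And>\<xi>. subspace \<xi> \<Longrightarrow> dim \<xi> = d \<Longrightarrow>
      \<exists>w\<in>\<xi>. (\<lambda>x. x + w) ` (orth_proj \<xi> ` K) \<subseteq> orth_proj \<xi> ` L"
  shows "\<exists>v. (\<lambda>x. x + v) ` K \<subseteq> C"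
proof -
  obtain m \<xi> D where dec: "d_decomposition d C m \<xi> D"
    using C by (auto simp: d_decomposable_def)
  then interpret direct_sum m \<xi>
    by unfold_locales (simp add: d_decomposition_def)
  have D: "D i \<subseteq> \<xi> i" "dim (\<xi> i) \<le> d" if "i < m" for i
    using dec that by (auto simp: d_decomposition_def)
  have C_eq: "C = (\<Sum>i<m. D i)" using dec by (simp add: d_decomposition_def)
  \<comment> \<open>Uniqueness of the decomposition identifies the summands of a point of
    \<open>C\<close> with its components.\<close>
  have comp_L: "component y i \<in> D i" if y: "y \<in> L" and i: "i < m" for y i
  proof -
    obtain s where "\<forall>i<m. s i \<in> D i" "y = (\<Sum>i<m. s i)"
      using subsetD[OF LC y] unfolding C_eq mem_set_sum_lessThan by blast
    then show ?thesis
      using component_eqI[of s y i] D i by fastforce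
  qed
  \<comment> \<open>Only component \<open>i\<close> of the translation matters here, so different
    indices may use unrelated subspaces \<zeta>; the chosen components are added at the end.\<close>
  have "\<exists>v. v \<in> \<xi> i \<and> (\<forall>x\<in>K. component x i + v \<in> D i)" if i: "i < m" for i
  proof -
    note lin = linear_component[OF i]
    have "dim (range (\<lambda>x. component x i)) \<le> d"
      using dim_subset[of "range (\<lambda>x. component x i)" "\<xi> i"] component_in[OF i] D(2)[OF i]
      by fastforce
    then obtain \<zeta> where \<zeta>: "subspace \<zeta>" "dim \<zeta> = d"
      "\<And>x. component (orth_proj \<zeta> x) i = component x i"
      using exists_orth_proj_factor[OF lin _ d] by metis
    obtain w where w: "(\<lambda>x. x + w) ` (orth_proj \<zeta> ` K) \<subseteq> orth_proj \<zeta> ` L"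
      using proj[OF \<zeta>(1,2)] by blast
    have "component x i + component w i \<in> D i" if x: "x \<in> K" for x
    proof -
      obtain y where y: "y \<in> L" "orth_proj \<zeta> x + w = orth_proj \<zeta> y"
        using w x by blast
      have "component x i + component w i = component (orth_proj \<zeta> x + w) i"
        by (simp add: linear_add[OF lin] \<zeta>(3))
      also have "\<dots> = component y i" by (simp add: y(2) \<zeta>(3))
      finally show ?thesis using comp_L[OF y(1) i] by simp
    qed
    then show ?thesis using component_in[OF i] by blast
  qed
  then obtain V where V: "\<And>i x. i < m \<Longrightarrow> x \<in> K \<Longrightarrow> component x i + V i \<in> D i"
    by metis
  have "x + (\<Sum>i<m. V i) \<in> C" if "x \<in> K" for x
    unfolding C_eq mem_set_sum_lessThan
    using V that by (intro exI[of _ "\<lambda>i. component x i + V i"]) (simp add: sum.distrib component_sum)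
  then show ?thesis by blast
qed

lemma translate_orth_proj_if_simplex_products:
  fixes K L :: "'a::euclidean_space set"
  assumes d: "1 \<le> d" and \<xi>: "subspace \<xi>" "dim \<xi> \<le> d"
    and K: "compact_convex K" and L: "compact_convex L"
    and products: "\<And>C. orthogonal_simplex_product d C \<Longrightarrow> L \<subseteq> C \<Longrightarrow> \<exists>v. (\<lambda>x. x + v) ` K \<subseteq> C"
  shows "\<exists>w\<in>\<xi>. (\<lambda>x. x + w) ` (orth_proj \<xi> ` K) \<subseteq> orth_proj \<xi> ` L"
proof (rule ccontr)
  assume no_translate: "\<not> ?thesis"
  obtain hK where hK: "\<And>x u. x \<in> K \<Longrightarrow> x \<bullet> u \<le> hK u" "\<And>u. \<exists>x\<in>K. hK u = x \<bullet> u"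
    using exists_support_function[OF K] by metis
  obtain hL where hL: "\<And>x u. x \<in> L \<Longrightarrow> x \<bullet> u \<le> hL u" "\<And>u. \<exists>x\<in>L. hL u = x \<bullet> u"
    using exists_support_function[OF L] by metis
  have infeasible: "\<exists>u\<in>\<xi>. hL u - hK u < w \<bullet> u" if w: "w \<in> \<xi>" for w
  proof (rule ccontr)
    assume feasible: "\<not> ?thesis"
    have "(x + w) \<bullet> u \<le> hL u" if "x \<in> K" "u \<in> \<xi>" for x u
    proof -
      have "w \<bullet> u \<le> hL u - hK u" using feasible that(2) by (meson leI)
      then show ?thesis using hK(1)[OF that(1), of u] by (simp add: inner_add_left)
    qed
    then have "(\<lambda>x. x + w) ` (orth_proj \<xi> ` K) \<subseteq> orth_proj \<xi> ` L"
      by (rule translate_orth_proj_subset[OF \<xi>(1) L w hL(2)])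
    with no_translate w show False by simp
  qed
  obtain F where F: "finite F" "F \<subseteq> \<xi>" "\<And>w. \<exists>u\<in>F. hL u - hK u < w \<bullet> u"
    using finite_infeasible_subset[OF \<xi>(1) infeasible] by metis
  obtain l where l: "\<forall>u\<in>F. 0 \<le> l u" "(\<Sum>u\<in>F. l u *\<^sub>R u) = 0" "(\<Sum>u\<in>F. l u * (hL u - hK u)) < 0"
    using farkas_alternative[OF F(1,3)] by metis
  obtain S k where S: "S \<subseteq> F" "positive_circuit S k" "(\<Sum>u\<in>S. k u * (hL u - hK u)) < 0"
    using exists_positive_circuit[OF F(1) l] by blast
  have fin: "finite S" using S(1) F(1) by (rule finite_subset)
  have ne: "S \<noteq> {}" using S(3) by auto
  have pos: "\<And>u. u \<in> S \<Longrightarrow> 0 < k u"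
    using S(2) by (auto simp: positive_circuit_def)
  note rel_inner = sum_inner_positive_circuit[OF S(2)]
  have sum_k: "0 < sum k S" using fin ne pos by (rule sum_pos)
  \<comment> \<open>Raising every bound by this amount uses half of the negative gap, so the
    weighted comparison with \<open>hK\<close> stays strict. It also makes the weighted sum of
    \<open>g\<close> positive even if that of \<open>hL\<close> is 0, so that the simplex does not
    degenerate.\<close>
  define \<epsilon> where "\<epsilon> = - (\<Sum>u\<in>S. k u * (hL u - hK u)) / (2 * sum k S)"
  have \<epsilon>: "0 < \<epsilon>" unfolding \<epsilon>_def using S(3) sum_k by (intro divide_pos_pos) auto
  define g where "g u = hL u + \<epsilon>" for u
  have sum_g: "(\<Sum>u\<in>S. k u * g u) = (\<Sum>u\<in>S. k u * hL u) + \<epsilon> * sum k S"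
    by (simp add: g_def distrib_left sum.distrib sum_distrib_left mult.commute)
  have "(\<Sum>u\<in>S. k u * g u) - (\<Sum>u\<in>S. k u * hK u) = (\<Sum>u\<in>S. k u * (hL u - hK u)) + \<epsilon> * sum k S"
    by (simp add: sum_g right_diff_distrib sum_subtractf)
  also have "\<dots> < 0" using S(3) sum_k by (simp add: \<epsilon>_def)
  finally have g_hK: "(\<Sum>u\<in>S. k u * g u) < (\<Sum>u\<in>S. k u * hK u)" by simp
  have "0 \<le> (\<Sum>u\<in>S. k u * hL u)"
  proof -
    obtain x where "x \<in> L" using hL(2) by blast
    then have "(\<Sum>u\<in>S. k u * (x \<bullet> u)) \<le> (\<Sum>u\<in>S. k u * hL u)"
      using pos hL(1) by (intro sum_mono mult_left_mono) (auto simp: less_imp_le)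
    then show ?thesis by (simp add: rel_inner)
  qed
  then have g_pos: "0 < (\<Sum>u\<in>S. k u * g u)"
    using \<epsilon> sum_k by (simp add: sum_g add_nonneg_pos)
  define T where "T = {x \<in> span S. \<forall>u\<in>S. x \<bullet> u \<le> g u}"
  have T: "(int (card S) - 1) simplex T"
    unfolding T_def by (rule circuit_polytope_simplex[OF S(2) fin g_pos])
  \<comment> \<open>The simplex \<open>T\<close> has dimension \<open>dim (span S)\<close>, which
    thus inherits the bound \<open>d\<close>.\<close>
  have "span S \<subseteq> \<xi>"
    using S(1) F(2) \<xi>(1) by (intro span_minimal) auto
  then have dim: "dim (span S) \<le> d"
    using dim_subset \<xi>(2) le_trans by blast
  have card: "card S = dim (span S) + 1"
    by (rule card_positive_circuit[OF S(2) fin ne])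
  have "orth_proj (span S) ` L \<subseteq> T"
  proof clarify
    fix x assume x: "x \<in> L"
    have "orth_proj (span S) x \<bullet> u \<le> g u" if "u \<in> S" for u
      using hL(1)[OF x, of u] \<epsilon> inner_orth_proj[of "span S" u x] that
      by (simp add: g_def span_base)
    then show "orth_proj (span S) x \<in> T"
      by (simp add: T_def orth_proj_in)
  qed
  moreover have "bounded L" using L by (simp add: compact_convex_def compact_imp_bounded)
  moreover have "0 \<le> int (card S) - 1" "int (card S) - 1 \<le> int d" "T \<subseteq> span S"
    using card dim by (auto simp: T_def)
  ultimately obtain C where C: "orthogonal_simplex_product d C" "L \<subseteq> C"
    "\<And>c. c \<in> C \<Longrightarrow> \<exists>t\<in>T. \<forall>u\<in>span S. c \<bullet> u = t \<bullet> u"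
    using simplex_cylinder[OF subspace_span dim d T] by metis
  obtain v where v: "(\<lambda>x. x + v) ` K \<subseteq> C"
    using products[OF C(1,2)] by blast
  \<comment> \<open>A translate of \<open>K\<close> inside \<open>C\<close> satisfies the bounds of
    \<open>T\<close>; summing them with weights \<open>k\<close> eliminates \<open>v\<close> and
    contradicts \<open>g_hK\<close>.\<close>
  have "hK u + v \<bullet> u \<le> g u" if u: "u \<in> S" for u
  proof -
    obtain x where x: "x \<in> K" "hK u = x \<bullet> u" using hK(2) by blast
    then obtain t where "t \<in> T" "(x + v) \<bullet> u = t \<bullet> u"
      using C(3)[of "x + v"] v u span_base by blast
    then show ?thesis using x(2) u by (simp add: T_def inner_add_left)
  qed
  then have "(\<Sum>u\<in>S. k u * (hK u + v \<bullet> u)) \<le> (\<Sum>u\<in>S. k u * g u)"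
    using pos by (intro sum_mono mult_left_mono) (auto simp: less_imp_le)
  moreover have "(\<Sum>u\<in>S. k u * (hK u + v \<bullet> u)) = (\<Sum>u\<in>S. k u * hK u)"
    by (simp add: distrib_left sum.distrib rel_inner)
  ultimately show False using g_hK by simp
qed

theorem theorem2p1:
  fixes K L :: "(real ^ 'n) set" and d :: nat
  assumes "CARD('n) \<ge> 2" and "1 \<le> d" and "d \<le> CARD('n) - 1"
    and "compact_convex K" and "compact_convex L"
  defines "cond_i \<equiv> (\<forall>C :: (real ^ 'n) set. d_decomposable d C \<and> L \<subseteq> C \<longrightarrow>
                (\<exists>v. (\<lambda>x. x + v) ` K \<subseteq> C))"
    and "cond_ii \<equiv> (\<forall>C :: (real ^ 'n) set. orthogonal_simplex_product d C \<and> L \<subseteq> C \<longrightarrow>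
                (\<exists>v. (\<lambda>x. x + v) ` K \<subseteq> C))"
    and "cond_iii \<equiv> (\<forall>\<xi> :: (real ^ 'n) set. subspace \<xi> \<and> dim \<xi> = d \<longrightarrow>
                (\<exists>w\<in>\<xi>. (\<lambda>x. x + w) ` (orth_proj \<xi> ` K) \<subseteq> orth_proj \<xi> ` L))"
  shows "(cond_i \<longleftrightarrow> cond_ii) \<and> (cond_ii \<longleftrightarrow> cond_iii)"
proof -
  \<comment> \<open>The implications run in a cycle; this one only forgets the simplices and the
    orthogonality.\<close>
  have "cond_ii" if i: cond_i
    unfolding cond_ii_def
  proof (intro allI impI)
    fix C :: "(real ^ 'n) set"
    assume "orthogonal_simplex_product d C \<and> L \<subseteq> C"
    then have "d_decomposable d C \<and> L \<subseteq> C"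
      unfolding orthogonal_simplex_product_def d_decomposable_def by blast
    then show "\<exists>v. (\<lambda>x. x + v) ` K \<subseteq> C"
      using i unfolding cond_i_def by blast
  qed
  moreover have "cond_iii" if ii: cond_ii
    unfolding cond_iii_def
  proof (intro allI impI)
    fix \<xi> :: "(real ^ 'n) set"
    assume "subspace \<xi> \<and> dim \<xi> = d"
    then show "\<exists>w\<in>\<xi>. (\<lambda>x. x + w) ` (orth_proj \<xi> ` K) \<subseteq> orth_proj \<xi> ` L"
      using ii assms(2,4,5) unfolding cond_ii_def
      by (intro translate_orth_proj_if_simplex_products[where d = d]) auto
  qed
  moreover have "cond_i" if iii: cond_iii
    unfolding cond_i_def
  proof (intro allI impI)
    fix C :: "(real ^ 'n) set"
    assume C: "d_decomposable d C \<and> L \<subseteq> C"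
    have "d \<le> DIM(real ^ 'n)" using assms(3) by simp
    then show "\<exists>v. (\<lambda>x. x + v) ` K \<subseteq> C"
      using C iii unfolding cond_iii_def by (intro translate_into_d_decomposable[where L = L]) auto
  qed
  ultimately show ?thesis by blast
qed

end
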